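(* Let $\ell$ be a positive integer coprime to $3$, let $q=2^m$ with $m$ a positive integer, let $a\in\mathbb{F}_q^*$ with $a\neq 1$ and $\mathrm{Tr}(1/a)=\mathrm{Tr}(1)$, let $b\in\mathbb{F}_q$ satisfy $b^2+b+1=1/a$, let $\omega\in\mathbb{F}_4\setminus\mathbb{F}_2$, and put $c:=(b+\omega)/(b+\omega^2)$. Let $\Gamma_\ell$ be the set of roots in $\mathbb{F}_{q^3}$ of $X^{2q^\ell+1}+X+a$ and $N_\ell:=|\Gamma_\ell|$. Define $f_0(X):=X^3+X+a$, $f_1(X):=ab^2X^3+X^2+a(b+1)^2X+a^2b^4$, $f_2(X):=a(b+1)^2X^3+X^2+ab^2X+a^2(b+1)^4$. Then: (1) if $m\not\equiv -\ell\pmod 3$ then $N_\ell=3$; (2) if $m\equiv-\ell\pmod 3$ then $N_\ell\in\{0,9\}$, and $N_\ell=9$ if and only if $c$ is a cube in $\mathbb{F}_{q^2}$. Moreover, $\Gamma_\ell$ is the set of roots of a polynomial $F(X)$ described as follows: - if $m\equiv 0\pmod 3$ and $c$ is a cube in $\mathbb{F}_{q^2}$ then $F=f_0$; - if $m\equiv 0\pmod 3$ and $c$ is not a cube in $\mathbb{F}_{q^2}$ then $F=f_i$ for some $i\in\{1,2\}$; - if $m\equiv\ell\pmod 3$ then there is a unique $i\in\{0,1,2\}$ for which $\omega^ic$ is a cube in $\mathbb{F}_{q^2}$; if $i=0$ then $F=f_0$, and otherwise $F=f_{3-i}$; - if $N_\ell=9$ then $F=f_0f_1f_2$.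
   Context: $\mathrm{Tr}$ denotes the trace map from $\mathbb{F}_q$ to $\mathbb{F}_2$. All fields are viewed inside a fixed algebraic closure of $\mathbb{F}_2$. *)

theory Defs
  imports
    "HOL-Algebra.Algebraic_Closure_Type"
    "HOL-Library.Z2"
    "HOL-Number_Theory.Cong"
begin

type_synonym F2_bar = "bit alg_closure"

(* For k = 2 ^ n with n > 0 this is the subfield with k elements: see the lemmas below. *)
definition GF :: "nat \<Rightarrow> F2_bar set" where
  "GF k = {x. x ^ k = x}"

lemma CHAR_F2_bar: "CHAR(F2_bar) = 2"
proof -
  have "CHAR(bit) dvd 2"
    by (subst of_nat_eq_0_iff_char_dvd [symmetric]) simp
  moreover have "CHAR(bit) \<noteq> 1"
    by simp
  ultimately have "CHAR(bit) = 2"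
    using prime_nat_iff two_is_prime_nat by blast
  then show ?thesis
    by simp
qed

lemma add_self_F2_bar: "x + x = (0 :: F2_bar)"
proof -
  have "of_nat 2 = (0 :: F2_bar)"
    using CHAR_F2_bar by (metis of_nat_CHAR)
  then have "(2 :: F2_bar) = 0"
    by simp
  then show ?thesis
    by (metis mult_2 mult_zero_left)
qed

lemma uminus_F2_bar: "- x = (x :: F2_bar)"
  using add_self_F2_bar minus_unique by blast

lemma add_power_two_power: "(x + y) ^ (2 ^ n) = x ^ (2 ^ n) + (y :: F2_bar) ^ (2 ^ n)"
proof (induction n)
  case (Suc n)
  have sq: "(u + v)\<^sup>2 = u\<^sup>2 + v\<^sup>2" for u v :: F2_bar
    using add_self_F2_bar [of "u * v"] by (simp add: power2_eq_square algebra_simps)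
  show ?case
    by (simp only: power_Suc2 power_mult Suc.IH sq)
qed simp

lemma zero_in_GF: "0 \<in> GF (2 ^ n)" and one_in_GF: "1 \<in> GF (2 ^ n)"
  by (auto simp: GF_def)

lemma add_in_GF: "x \<in> GF (2 ^ n) \<Longrightarrow> y \<in> GF (2 ^ n) \<Longrightarrow> x + y \<in> GF (2 ^ n)"
  by (simp add: GF_def add_power_two_power)

lemma uminus_in_GF: "x \<in> GF (2 ^ n) \<Longrightarrow> - x \<in> GF (2 ^ n)"
  by (simp add: uminus_F2_bar)

lemma mult_in_GF: "x \<in> GF k \<Longrightarrow> y \<in> GF k \<Longrightarrow> x * y \<in> GF k"
  by (simp add: GF_def power_mult_distrib)

lemma inverse_in_GF: "x \<in> GF k \<Longrightarrow> inverse x \<in> GF k"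
  by (simp add: GF_def power_inverse)

lemma card_GF:
  assumes "n > 0"
  shows "card (GF (2 ^ n)) = 2 ^ n"
proof -
  define p where "p = (monom 1 (2 ^ n) + monom 1 1 :: F2_bar poly)"
  have gt: "(1 :: nat) < 2 ^ n"
    using assms by (metis one_less_numeral_iff one_less_power semiring_norm(76))
  have deg: "degree p = 2 ^ n"
    unfolding p_def using gt by (subst degree_add_eq_left) (auto simp: degree_monom_eq)
  then have nz: "p \<noteq> 0"
    using gt by auto
  have two: "of_nat (2 ^ n) = (0 :: F2_bar)"
    using assms CHAR_F2_bar by (simp add: of_nat_eq_0_iff_char_dvd del: of_nat_power)
  have pd: "pderiv p = 1"
    unfolding p_def
    using two by (simp add: pderiv_add pderiv_monom monom_0 one_pCons del: of_nat_power)
  obtain A L where A: "size A = degree p" "p = smult L (\<Prod>x\<in>#A. [:- x, 1:])" "L \<noteq> 0"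
    using alg_closed_imp_factorization [OF nz] nz by (metis leading_coeff_0_iff)
  have no_double: "x \<notin># B" if "A = add_mset x B" for x B
  proof
    assume "x \<in># B"
    then obtain C where "B = add_mset x C"
      by (rule mset_add)
    with that have "A = add_mset x (add_mset x C)"
      by simp
    then have "(\<Prod>x\<in>#A. [:- x, 1:]) = [:- x, 1:] * ([:- x, 1:] * (\<Prod>x\<in>#C. [:- x, 1:]))"
      by (simp only: image_mset_add_mset prod_mset.add_mset)
    with A(2) have "p = smult L ([:- x, 1:] * ([:- x, 1:] * (\<Prod>x\<in>#C. [:- x, 1:])))"
      by (simp only:)
    then obtain r where r: "p = [:- x, 1:] * ([:- x, 1:] * r)"
      unfolding mult_smult_right [symmetric] by blast
    have "poly (pderiv p) x = 0"
      by (simp only: r pderiv_mult poly_add poly_mult) simp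
    then show False
      by (simp add: pd del: One_nat_def)
  qed
  have "card (set_mset A) = size A"
    using no_double
  proof (induction A)
    case (add x A)
    have "x \<notin># A"
      using add.prems by blast
    moreover have "y \<notin># B" if "A = add_mset y B" for y B
      using add.prems [of y "add_mset x B"] that by (auto simp: add_mset_commute)
    then have "card (set_mset A) = size A"
      by (rule add.IH)
    ultimately show ?case
      by simp
  qed simp
  moreover have "GF (2 ^ n) = set_mset A"
  proof -
    have "poly p x = 0 \<longleftrightarrow> x \<in># A" for x
    proof -
      have "poly p x = L * (\<Prod>y\<in>#A. x - y)"
        using arg_cong [OF A(2), of "\<lambda>r. poly r x"]
        by (simp only: poly_smult poly_prod_mset image_mset.compositionality o_def) simp
      then show ?thesis
        using A(3) by (auto simp: prod_mset_zero_iff)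
    qed
    moreover have "poly p x = 0 \<longleftrightarrow> x \<in> GF (2 ^ n)" for x
      using uminus_F2_bar by (auto simp: GF_def poly_monom add_eq_0_iff2 p_def)
    ultimately show ?thesis
      by blast
  qed
  ultimately show ?thesis
    using A(1) deg by simp
qed

(* The absolute trace from GF (2 ^ m) to GF 2. *)
definition trace :: "nat \<Rightarrow> F2_bar \<Rightarrow> F2_bar" where
  "trace m x = (\<Sum>i<m. x ^ (2 ^ i))"

definition is_cube_in :: "F2_bar set \<Rightarrow> F2_bar \<Rightarrow> bool" where
  "is_cube_in K x \<longleftrightarrow> (\<exists>y\<in>K. x = y ^ 3)"

definition roots :: "F2_bar poly \<Rightarrow> F2_bar set" where
  "roots p = {x. poly p x = 0}"

definition Gamma :: "nat \<Rightarrow> nat \<Rightarrow> F2_bar \<Rightarrow> F2_bar set" where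
  "Gamma l q a = roots (monom 1 (2 * q ^ l + 1) + monom 1 1 + [:a:]) \<inter> GF (q ^ 3)"

definition f0 :: "F2_bar \<Rightarrow> F2_bar poly" where
  "f0 a = [:a, 1, 0, 1:]"

definition f1 :: "F2_bar \<Rightarrow> F2_bar \<Rightarrow> F2_bar poly" where
  "f1 a b = [:a\<^sup>2 * b ^ 4, a * (b + 1)\<^sup>2, 1, a * b\<^sup>2:]"

definition f2 :: "F2_bar \<Rightarrow> F2_bar \<Rightarrow> F2_bar poly" where
  "f2 a b = [:a\<^sup>2 * (b + 1) ^ 4, a * b\<^sup>2, 1, a * (b + 1)\<^sup>2:]"

end

theory Submission
  imports Defs
begin

text \<open>
  Write \<open>y = x ^ (q ^ l)\<close>, a Galois conjugate of \<open>x\<close> over the field with \<open>q\<close> elements. Then \<open>x\<close> is in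
  \<open>\<Gamma>\<close> iff \<open>x\<close> has degree dividing 3 and \<open>x = a / (y + 1)\<^sup>2\<close>. The map \<open>t \<mapsto> a / (t + 1)\<^sup>2\<close>
  interchanges \<open>c\<close> and \<open>1 / c\<close>, because \<open>a = c + 1 / c\<close>. In the coordinate \<open>u = (t + c) / (c t + 1)\<close> it is
  therefore monomial, namely \<open>u \<mapsto> 1 / (c u\<^sup>2)\<close>, while the \<open>q\<close>-Frobenius becomes \<open>u \<mapsto> u ^ Q\<close> with
  \<open>Q = (- 2) ^ m\<close> (the sign accounts for the Frobenius inverting \<open>c\<close> when \<open>m\<close> is odd), and \<open>c ^ Q = c\<close>.
  Iterating three times gives \<open>(c u\<^sup>3)\<^sup>3 = 1\<close>, so \<open>c u\<^sup>3 = \<omega> ^ j\<close> for some \<open>j\<close>; the values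
  \<open>j = 0, 1, 2\<close> correspond to the roots of \<open>f\<^sub>0\<close>, \<open>f\<^sub>2\<close>, \<open>f\<^sub>1\<close>. With \<open>c ^ ((Q - 1) / 3) = \<omega> ^ e\<close> all three roots
  of a given \<open>j\<close> lie in \<open>\<Gamma>\<close> iff \<open>e + j (m + l) \<equiv> 0\<close> modulo 3, and otherwise none does. Finally \<open>\<omega> ^ i c\<close> is
  a cube iff \<open>e \<equiv> i m\<close> modulo 3.
\<close>

section \<open>Arithmetic in characteristic two\<close>

lemma add_left_self_F2_bar: "x + (x + y) = (y :: F2_bar)"
  by (metis add.assoc add_0 add_self_F2_bar)

lemma numeral_Bit0_F2_bar: "numeral (Num.Bit0 n) = (0 :: F2_bar)"
  by (metis numeral_Bit0 add_self_F2_bar)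

lemma numeral_Bit1_F2_bar: "numeral (Num.Bit1 n) = (1 :: F2_bar)"
  by (metis numeral_Bit1 add_self_F2_bar add_0)

lemma diff_F2_bar: "x - y = x + (y :: F2_bar)"
  by (metis uminus_F2_bar diff_conv_add_uminus)

lemma add_eq_0_F2_bar: "x + y = (0 :: F2_bar) \<longleftrightarrow> x = y"
  by (simp add: add_eq_0_iff2 uminus_F2_bar)

lemmas char2 = add_self_F2_bar add_left_self_F2_bar numeral_Bit0_F2_bar numeral_Bit1_F2_bar
  diff_F2_bar uminus_F2_bar

lemmas expand_simps = algebra_simps power2_eq_square power3_eq_cube power4_eq_xxxx

section \<open>The Cayley coordinate\<close>

text \<open>
  At the pole \<open>t = 1 / c\<close> division by zero gives the value \<open>0\<close>, which is also the value at \<open>t = c\<close>.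
\<close>

definition cayley :: "F2_bar \<Rightarrow> F2_bar \<Rightarrow> F2_bar" where
  "cayley c t = (t + c) / (c * t + 1)"

text \<open>The matrix with rows (1, c) and (c, 1) has square \<open>c^2 + 1\<close> times the
  identity in characteristic two, so \<open>cayley c\<close> is an involution away from its
  pole.\<close>

lemma cayley_cayley:
  assumes "c\<^sup>2 \<noteq> 1" "c * t \<noteq> 1"
  shows "cayley c (cayley c t) = t"
proof -
  have nz: "c * t + 1 \<noteq> 0" "c\<^sup>2 + 1 \<noteq> 0"
    using assms by (simp_all add: add_eq_0_F2_bar)
  have "cayley c t + c = (c\<^sup>2 + 1) * t / (c * t + 1)"
    "c * cayley c t + 1 = (c\<^sup>2 + 1) / (c * t + 1)"
  proof -
    have "cayley c t + c = (t + c + c * (c * t + 1)) / (c * t + 1)"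
      "c * cayley c t + 1 = (c * (t + c) + (c * t + 1)) / (c * t + 1)"
      using nz(1) by (simp_all add: cayley_def add_divide_distrib [of "_ + c"]
          add_divide_distrib [of "_ * (_ + c)"])
    moreover have "t + c + c * (c * t + 1) = (c\<^sup>2 + 1) * t" "c * (t + c) + (c * t + 1) = c\<^sup>2 + 1"
      by (simp_all add: char2 expand_simps)
    ultimately show "cayley c t + c = (c\<^sup>2 + 1) * t / (c * t + 1)"
      "c * cayley c t + 1 = (c\<^sup>2 + 1) / (c * t + 1)"
      by simp_all
  qed
  then show ?thesis
    using nz unfolding cayley_def [of c "cayley c t"] by simp
qed

text \<open>Nonzero values keep \<open>x\<close> and \<open>y\<close> away from \<open>c\<close> and
  \<open>1 / c\<close>, so denominators can be cleared; the cleared right-hand equation is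
  \<open>c * (c^2 + 1)\<close> times the left-hand one.\<close>

lemma cayley_conjugates_step:
  assumes "a * c = c\<^sup>2 + 1" "c \<noteq> 0" "c\<^sup>2 \<noteq> 1" "cayley c x \<noteq> 0" "cayley c y \<noteq> 0"
  shows "x * (y + 1)\<^sup>2 = a \<longleftrightarrow> c * cayley c x * (cayley c y)\<^sup>2 = 1"
proof -
  have nz: "x + c \<noteq> 0" "c * x + 1 \<noteq> 0" "y + c \<noteq> 0" "c * y + 1 \<noteq> 0" "c\<^sup>2 + 1 \<noteq> 0"
    using assms(3,4,5) by (simp_all add: cayley_def add_eq_0_F2_bar)
  have "c * (x + c) * (y + c)\<^sup>2 + (c * x + 1) * (c * y + 1)\<^sup>2 =
      c * (c\<^sup>2 + 1) * (x * (y + 1)\<^sup>2) + (c\<^sup>2 + 1) * (c\<^sup>2 + 1)"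
    by (simp add: char2 expand_simps)
  also have "\<dots> = c * (c\<^sup>2 + 1) * (x * (y + 1)\<^sup>2 + a)"
    unfolding assms(1) [symmetric] by (simp add: algebra_simps)
  finally have eq: "c * (x + c) * (y + c)\<^sup>2 + (c * x + 1) * (c * y + 1)\<^sup>2 =
      c * (c\<^sup>2 + 1) * (x * (y + 1)\<^sup>2 + a)" .
  have "x * (y + 1)\<^sup>2 = a \<longleftrightarrow> c * (c\<^sup>2 + 1) * (x * (y + 1)\<^sup>2 + a) = 0"
    using nz(5) assms(2) by (simp add: add_eq_0_F2_bar)
  also have "\<dots> \<longleftrightarrow> c * (x + c) * (y + c)\<^sup>2 = (c * x + 1) * (c * y + 1)\<^sup>2"
    unfolding eq [symmetric] by (rule add_eq_0_F2_bar)
  also have "\<dots> \<longleftrightarrow> c * cayley c x * (cayley c y)\<^sup>2 = 1"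
    using nz by (simp add: cayley_def divide_simps)
  finally show ?thesis .
qed

section \<open>The three cubics in the Cayley coordinate\<close>

lemma omega_mult_omega:
  fixes \<omega> :: F2_bar
  assumes "\<omega>\<^sup>2 = \<omega> + 1"
  shows "\<omega> * \<omega> = \<omega> + 1" and "\<omega> * (\<omega> * z) = \<omega> * z + z"
proof -
  show "\<omega> * \<omega> = \<omega> + 1"
    using assms by (simp only: power2_eq_square)
  then show "\<omega> * (\<omega> * z) = \<omega> * z + z"
    by (simp add: distrib_right flip: mult.assoc)
qed

text \<open>Up to a factor, each cubic is a combination of the cubes of \<open>x + c\<close> and
  \<open>c * x + 1\<close>, so that its roots become the solutions of \<open>c * u ^ 3 = d\<close>
  with \<open>d\<close> a cube root of unity.\<close>

lemma
  fixes a b c \<omega> x :: F2_bar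
  assumes ac: "a * c = c\<^sup>2 + 1" and \<omega>: "\<omega>\<^sup>2 = \<omega> + 1" and bc: "b * (c + 1) = \<omega>\<^sup>2 * c + \<omega>"
  shows poly_f0: "poly (f0 a) x * (c * (c\<^sup>2 + 1)) = c * (x + c) ^ 3 + (c * x + 1) ^ 3"
    and poly_f1: "poly (f1 a b) x * (c\<^sup>2 * \<omega>) = c * (x + c) ^ 3 + \<omega>\<^sup>2 * (c * x + 1) ^ 3"
    and poly_f2: "poly (f2 a b) x * (c\<^sup>2 * \<omega>\<^sup>2) = c * (x + c) ^ 3 + \<omega> * (c * x + 1) ^ 3"
proof -
  note \<omega>' = omega_mult_omega [OF \<omega>]
  \<comment> \<open>Since \<open>a * c\<close> is the square of \<open>c + 1\<close>, this is the
    square of \<open>bc\<close>.\<close>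
  have b: "a * b\<^sup>2 * c = \<omega> * c\<^sup>2 + \<omega>\<^sup>2"
  proof -
    have "a * b\<^sup>2 * c = b\<^sup>2 * (a * c)"
      by simp
    also have "\<dots> = (b * (c + 1))\<^sup>2"
      unfolding ac by (simp add: expand_simps char2)
    also have "\<dots> = \<omega> * c\<^sup>2 + \<omega>\<^sup>2"
      unfolding bc by (simp add: expand_simps char2 \<omega>')
    finally show ?thesis .
  qed
  have b': "a * (b + 1)\<^sup>2 * c = \<omega>\<^sup>2 * c\<^sup>2 + \<omega>"
  proof -
    have "a * (b + 1)\<^sup>2 * c = a * b\<^sup>2 * c + a * c"
      by (simp add: expand_simps char2)
    then show ?thesis
      unfolding b ac by (simp add: expand_simps char2 \<omega>')
  qed
  show "poly (f0 a) x * (c * (c\<^sup>2 + 1)) = c * (x + c) ^ 3 + (c * x + 1) ^ 3"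
  proof -
    have "poly (f0 a) x * (c * (c\<^sup>2 + 1)) = (x ^ 3 + x) * (c * (c\<^sup>2 + 1)) + (a * c) * (c\<^sup>2 + 1)"
      by (simp add: f0_def expand_simps)
    then show ?thesis
      unfolding ac by (simp add: expand_simps char2)
  qed
  show "poly (f1 a b) x * (c\<^sup>2 * \<omega>) = c * (x + c) ^ 3 + \<omega>\<^sup>2 * (c * x + 1) ^ 3"
  proof -
    have "poly (f1 a b) x * (c\<^sup>2 * \<omega>) = c * \<omega> * x ^ 3 * (a * b\<^sup>2 * c) + c\<^sup>2 * \<omega> * x\<^sup>2
        + c * \<omega> * x * (a * (b + 1)\<^sup>2 * c) + \<omega> * (a * b\<^sup>2 * c)\<^sup>2"
      unfolding f1_def by (simp add: expand_simps)
    then show ?thesis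
      unfolding b b' by (simp add: expand_simps char2 \<omega>')
  qed
  show "poly (f2 a b) x * (c\<^sup>2 * \<omega>\<^sup>2) = c * (x + c) ^ 3 + \<omega> * (c * x + 1) ^ 3"
  proof -
    have "poly (f2 a b) x * (c\<^sup>2 * \<omega>\<^sup>2) = c * \<omega>\<^sup>2 * x ^ 3 * (a * (b + 1)\<^sup>2 * c) + c\<^sup>2 * \<omega>\<^sup>2 * x\<^sup>2
        + c * \<omega>\<^sup>2 * x * (a * b\<^sup>2 * c) + \<omega>\<^sup>2 * (a * (b + 1)\<^sup>2 * c)\<^sup>2"
    proof -
      have "(a * (b + 1)\<^sup>2 * c)\<^sup>2 = a\<^sup>2 * (b + 1) ^ 4 * c\<^sup>2"
        by (simp add: power_mult_distrib flip: power_mult)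
      then show ?thesis
        unfolding f2_def by (simp add: algebra_simps power2_eq_square power3_eq_cube)
    qed
    then show ?thesis
      unfolding b b' by (simp add: expand_simps char2 \<omega>')
  qed
qed

section \<open>Monomial conditions and exponents modulo 3\<close>

lemma omega_powi_eq_1_iff:
  fixes \<omega> :: "'a :: field"
  assumes "\<omega> ^ 3 = 1" "\<omega> \<noteq> 1"
  shows "\<omega> powi i = 1 \<longleftrightarrow> 3 dvd i"
proof -
  have nz: "\<omega> \<noteq> 0"
    using assms(1) by auto
  have "\<omega> powi i = \<omega> powi (3 * (i div 3) + i mod 3)"
    by simp
  also have "\<dots> = (\<omega> powi 3) powi (i div 3) * \<omega> powi (i mod 3)"
    by (simp only: power_int_add [OF disjI1 [OF nz]] power_int_mult)
  also have "\<dots> = \<omega> powi (i mod 3)"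
    using assms(1) by simp
  finally have *: "\<omega> powi i = \<omega> powi (i mod 3)" .
  have "\<omega> ^ 2 \<noteq> 1"
  proof
    assume "\<omega> ^ 2 = 1"
    then have "\<omega> ^ 3 = \<omega>"
      by (simp add: power3_eq_cube power2_eq_square)
    with assms show False
      by simp
  qed
  moreover have "i mod 3 = 0 \<or> i mod 3 = 1 \<or> i mod 3 = 2"
    by auto
  ultimately show ?thesis
    unfolding * using assms(2) by (auto simp: dvd_eq_mod_eq_0)
qed

text \<open>
  Expanding \<open>(1 - 3) ^ m\<close> modulo 9 gives \<open>k \<equiv> - m\<close> modulo 3.
\<close>

lemma minus_two_power_mod_9:
  obtains k :: int where "(- 2) ^ m = 1 + 3 * k" "3 dvd k + int m"
proof -
  have "\<exists>k :: int. (- 2) ^ m = 1 + 3 * k \<and> 3 dvd k + int m"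
  proof (induction m)
    case (Suc m)
    then obtain k :: int where k: "(- 2) ^ m = 1 + 3 * k" "3 dvd k + int m"
      by blast
    have "(- 2) ^ Suc m = 1 + 3 * (- 1 - 2 * k)" "3 dvd (- 1 - 2 * k) + int (Suc m)"
      using k by (simp_all, presburger)
    then show ?case
      by blast
  qed (rule exI [of _ 0], simp)
  then show thesis
    using that by blast
qed

lemma powi_power_fixed:
  fixes c :: "'a :: field"
  assumes "c powi Q = c"
  shows "c powi (Q ^ n) = c"
proof (induction n)
  case (Suc n)
  have "c powi (Q ^ Suc n) = (c powi Q) powi (Q ^ n)"
    by (simp add: power_int_mult)
  then show ?case
    using assms Suc by simp
qed simp

text \<open>Serves to cancel \<open>l\<close>, its own inverse modulo 3, from a divisibility
  condition on exponents.\<close>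

lemma coprime_3_square:
  assumes "coprime l (3 :: nat)"
  shows "\<exists>t. int l * int l = 1 + 3 * t"
proof -
  have "\<not> 3 dvd l"
    using assms by (metis coprime_absorb_right nat_dvd_1_iff_1 numeral_eq_one_iff semiring_norm(86))
  then have "l = 3 * (l div 3) + 1 \<or> l = 3 * (l div 3) + 2"
    by presburger
  then obtain n where "int l = 3 * n + 1 \<or> int l = 3 * n + 2"
    by (metis of_nat_add of_nat_mult of_nat_numeral of_nat_1)
  then have "int l * int l = 1 + 3 * (3 * n * n + 2 * n) \<or> int l * int l = 1 + 3 * (3 * n * n + 4 * n + 1)"
    by (auto simp: algebra_simps)
  then show ?thesis
    by blast
qed

text \<open>The left side is membership in \<open>Gamma\<close> written in the coordinate
  \<open>u\<close>. Once \<open>c * u ^ 3 = \<omega> ^ j\<close>, each conjugate of \<open>u\<close>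
  is \<open>u\<close> times a power of \<omega>, and the conditions become a congruence modulo 3.
  Iterating the second condition three times shows that such a \<open>j\<close> exists.\<close>

lemma powi_conditions_iff:
  fixes u c \<omega> :: "'a :: field" and Q k e :: int and l m :: nat
  assumes nz: "u \<noteq> 0" "c \<noteq> 0"
    and Q: "Q = 1 + 3 * k" "3 dvd k + int m" "c powi Q = c"
    and \<omega>: "\<omega> ^ 3 = 1" "\<omega> \<noteq> 1" "\<And>z. z ^ 3 = 1 \<Longrightarrow> \<exists>j\<in>{0, 1, 2}. z = \<omega> ^ j"
    and e: "c powi k = \<omega> powi e"
    and l: "coprime l 3"
  shows "u powi (Q ^ 3) = u \<and> c * u * (u powi (Q ^ l))\<^sup>2 = 1 \<longleftrightarrow>
    (\<exists>j\<in>{0, 1, 2}. c * u ^ 3 = \<omega> ^ j \<and> 3 dvd e + int j * (int m + int l))"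
    (is "?L \<longleftrightarrow> ?R")
proof -
  have \<omega>nz: "\<omega> \<noteq> 0"
    using \<omega>(1) by auto
  have iff: "u powi (Q ^ 3) = u \<and> (c * u * (u powi (Q ^ l))\<^sup>2 = 1 \<longleftrightarrow>
      3 dvd e + int j * (int m + int l))" if j: "c * u ^ 3 = \<omega> ^ j" for j
  proof -
    \<comment> \<open>\<open>r\<close> is \<open>u\<close> to the power
      \<open>Q - 1 = 3 * k\<close>, computed from \<open>c * u ^ 3\<close> and
      \<open>c powi k\<close>.\<close>
    define r where "r = \<omega> powi (int j * k - e)"
    have uQ: "u powi Q = u * r"
    proof -
      have "(c * u ^ 3) powi k = \<omega> powi (int j * k)"
        unfolding j by (simp add: power_int_mult)
      then have "(u ^ 3) powi k = r"
        using e \<omega>nz nz unfolding r_def power_int_mult_distrib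
        by (simp add: power_int_diff field_simps)
      moreover have "u powi (3 * k) = (u ^ 3) powi k"
        by (simp add: power_int_mult)
      ultimately show ?thesis
        using nz by (simp add: Q(1) power_int_add)
    qed
    have \<omega>Q: "\<omega> powi Q = \<omega>"
      using \<omega>nz \<omega>(1) by (simp add: Q(1) power_int_add power_int_mult)
    have rQ: "r powi Q = r"
      unfolding r_def by (metis \<omega>Q power_int_mult mult.commute)
    have uQn: "u powi (Q ^ n) = u * r ^ n" for n
    proof (induction n)
      case (Suc n)
      have "u powi (Q ^ Suc n) = (u powi (Q ^ n)) powi Q"
        by (metis power_int_mult power_Suc2)
      also have "\<dots> = u powi Q * (r powi Q) ^ n"
        unfolding Suc power_int_mult_distrib by (metis power_int_mult power_int_of_nat mult.commute)
      finally show ?case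
        unfolding uQ rQ by simp
    qed simp
    have "r ^ 3 = \<omega> powi ((int j * k - e) * 3)"
      unfolding r_def by (simp only: power_int_mult power_int_numeral)
    then have "r ^ 3 = 1"
      by (simp add: omega_powi_eq_1_iff [OF \<omega>(1,2)])
    then have "u powi (Q ^ 3) = u"
      by (simp add: uQn)
    moreover have "c * u * (u powi (Q ^ l))\<^sup>2 = 1 \<longleftrightarrow> 3 dvd e + int j * (int m + int l)"
    proof -
      have "c * u * (u powi (Q ^ l))\<^sup>2 = (c * u ^ 3) * r ^ (l * 2)"
        unfolding uQn by (simp add: power2_eq_square power3_eq_cube power_mult)
      also have "\<dots> = \<omega> powi (int j + (int j * k - e) * int (l * 2))"
        unfolding j r_def power_int_add [OF disjI1 [OF \<omega>nz]] power_int_mult power_int_of_nat ..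
      finally have "c * u * (u powi (Q ^ l))\<^sup>2 = 1 \<longleftrightarrow>
          3 dvd int j + (int j * k - e) * int (l * 2)"
        by (simp only: omega_powi_eq_1_iff [OF \<omega>(1,2)])
      \<comment> \<open>Multiplication by \<open>l\<close> is invertible modulo 3; with
        \<open>l^2 = 1\<close>, \<open>2 = -1\<close> and \<open>k = -m\<close> modulo 3 it brings
        the exponent to the desired form.\<close>
      also have "\<dots> \<longleftrightarrow> 3 dvd int l * (int j + (int j * k - e) * int (l * 2))"
        using l by (simp add: coprime_dvd_mult_right_iff coprime_commute flip: coprime_int_iff)
      also have "\<dots> \<longleftrightarrow> 3 dvd e + int j * (int m + int l)"
      proof -
        obtain s where s: "k + int m = 3 * s"
          using Q(2) by (rule dvdE)
        obtain t where t: "int l * int l = 1 + 3 * t"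
          using coprime_3_square [OF l] by blast
        have "int l * (int j + (int j * k - e) * int (l * 2)) =
            int l * int j + 2 * (int l * int l) * (int j * k - e)"
          by (simp add: algebra_simps)
        also have "\<dots> = e + int j * (3 * s - k + int l) - 3 * (e + int j * s - int j * k - 2 * t * (int j * k - e))"
          unfolding t by (simp add: algebra_simps)
        also have "3 * s - k = int m"
          using s by simp
        finally show ?thesis
          by (metis dvd_add_left_iff diff_add_cancel dvd_triv_left)
      qed
      finally show ?thesis .
    qed
    ultimately show ?thesis ..
  qed
  have "\<exists>j\<in>{0, 1, 2}. c * u ^ 3 = \<omega> ^ j" if L: ?L
  proof -
    \<comment> \<open>The orbit \<open>u\<close>, \<open>v\<close>, \<open>w\<close> under the
      \<open>P\<close>-th power closes after three steps, because \<open>P ^ 3\<close> is a power of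
      \<open>Q ^ 3\<close>.\<close>
    define P where "P = Q ^ l"
    define v w where "v = u powi P" and "w = v powi P"
    have cP: "c powi P = c"
      unfolding P_def by (rule powi_power_fixed [OF Q(3)])
    have step: "c * x powi P * (y powi P)\<^sup>2 = 1" if "c * x * y\<^sup>2 = 1" for x y
    proof -
      have "(c * x * y\<^sup>2) powi P = c * x powi P * (y powi P)\<^sup>2"
        unfolding power_int_mult_distrib cP
        by (metis power_int_mult power_int_numeral mult.commute)
      with that show ?thesis
        by simp
    qed
    have "w powi P = u powi ((Q ^ 3) ^ l)"
    proof -
      have "(Q ^ 3) ^ l = P * P * P"
        unfolding P_def by (metis power3_eq_cube power_mult mult.commute)
      then show ?thesis
        by (simp only: w_def v_def power_int_mult)
    qed
    also have "\<dots> = u"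
      using L by (intro powi_power_fixed [where Q = "Q ^ 3"]) simp
    finally have wP: "w powi P = u" .
    have uv: "c * u * v\<^sup>2 = 1"
      using L by (simp add: v_def P_def)
    have vw: "c * v * w\<^sup>2 = 1"
      using step [OF uv] by (simp add: v_def w_def)
    have wu: "c * w * u\<^sup>2 = 1"
      using step [OF vw] by (simp add: wP flip: w_def)
    \<comment> \<open>Eliminating \<open>w\<close> from the last two relations expresses
      \<open>v\<close> by \<open>u\<close>; the first relation then becomes the cube of
      \<open>c * u ^ 3\<close>.\<close>
    have "w = 1 / (c * u\<^sup>2)"
      using wu nz by (simp add: field_simps)
    with vw nz have "v = c * u ^ 4"
      by (simp add: field_simps power2_eq_square power4_eq_xxxx)
    then have "(c * u ^ 3) ^ 3 = c * u * v\<^sup>2"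
      by (simp add: power2_eq_square power3_eq_cube power4_eq_xxxx mult_ac)
    with uv have "(c * u ^ 3) ^ 3 = 1"
      by simp
    then show ?thesis
      by (rule \<omega>(3))
  qed
  then show ?thesis
    using iff by blast
qed

section \<open>Frobenius in the Cayley coordinate, and a criterion for cubes\<close>

text \<open>
  For odd \<open>M\<close> the hypothesis says that the Frobenius sends \<open>c\<close> to \<open>1 / c\<close>, hence \<open>cayley c x\<close> to the
  inverse of \<open>cayley c\<close> at the conjugate of \<open>x\<close>; the sign of \<open>- 2\<close> absorbs this inversion.
\<close>

lemma cayley_Frobenius:
  assumes "c powi ((- 2) ^ M) = c" "c \<noteq> 0"
  shows "cayley c (x ^ (2 ^ M)) = cayley c x powi ((- 2) ^ M)"
proof (cases "even M")
  case True
  then have M: "(- 2 :: int) ^ M = int (2 ^ M)"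
    by simp
  then have "c ^ (2 ^ M) = c"
    using assms by (simp only: power_int_of_nat)
  then show ?thesis
    unfolding cayley_def M power_int_of_nat
    by (simp add: power_divide power_mult_distrib add_power_two_power)
next
  case False
  then have M: "(- 2 :: int) ^ M = - int (2 ^ M)"
    by simp
  then have "inverse (c ^ (2 ^ M)) = c"
    using assms by (simp only: power_int_minus power_int_of_nat)
  then have "c ^ (2 ^ M) = inverse c"
    by (metis inverse_inverse_eq)
  then have "cayley c x powi ((- 2) ^ M) =
      (inverse c * x ^ (2 ^ M) + 1) / (x ^ (2 ^ M) + inverse c)"
    unfolding cayley_def M power_int_minus power_int_of_nat
    by (simp add: power_divide power_mult_distrib add_power_two_power)
  also have "\<dots> = (c * (inverse c * x ^ (2 ^ M) + 1)) / (c * (x ^ (2 ^ M) + inverse c))"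
    using assms(2) by simp
  also have "\<dots> = cayley c (x ^ (2 ^ M))"
    using assms(2) by (simp add: cayley_def distrib_left flip: mult.assoc)
  finally show ?thesis ..
qed

lemma is_cube_in_iff:
  fixes z :: F2_bar
  assumes "z \<noteq> 0" "z powi Q = z" "Q = (- 2) ^ m" "Q = 1 + 3 * k"
  shows "is_cube_in (GF ((2 ^ m)\<^sup>2)) z \<longleftrightarrow> z powi k = 1"
proof -
  have QQ: "Q * Q = int ((2 ^ m)\<^sup>2)"
    unfolding assms(3) by (simp add: power2_eq_square flip: power_mult_distrib)
  have GF_iff: "y \<in> GF ((2 ^ m)\<^sup>2) \<longleftrightarrow> y powi (Q * Q) = y" for y
    unfolding GF_def QQ power_int_of_nat by simp
  have "z powi (1 + 3 * k) = z"
    using assms(2,4) by simp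
  then have zk: "(z powi k) ^ 3 = 1"
    using assms(1) by (simp add: power_int_add power_int_mult mult.commute [of 3])
  show ?thesis
  proof
    assume "is_cube_in (GF ((2 ^ m)\<^sup>2)) z"
    then obtain y where y: "y powi (Q * Q) = y" "z = y ^ 3"
      unfolding is_cube_in_def using GF_iff by blast
    have y0: "y \<noteq> 0"
      using y(2) assms(1) by auto
    have "y powi (1 + (3 * k) * (2 + 3 * k)) = y"
      using y(1) unfolding assms(4) by (simp add: algebra_simps)
    then have "y powi ((3 * k) * (2 + 3 * k)) = 1"
      using y0 by (simp only: power_int_add [OF disjI1 [OF y0]]) simp
    moreover have "y powi (3 * k) = z powi k"
      unfolding y(2) by (simp add: power_int_mult)
    ultimately have "(z powi k) powi (2 + 3 * k) = 1"
      by (simp only: power_int_mult)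
    moreover have "(z powi k) powi (2 + 3 * k) = (z powi k)\<^sup>2 * ((z powi k) ^ 3) powi k"
      using assms(1) by (simp add: power_int_add power_int_mult)
    ultimately have "(z powi k)\<^sup>2 = 1"
      using zk by simp
    with zk show "z powi k = 1"
      by (simp add: power3_eq_cube power2_eq_square)
  next
    assume zk1: "z powi k = 1"
    \<comment> \<open>Any cube root in the algebraic closure will do: its power \<open>3 * k\<close>
      is 1, so \<open>Q\<close> and hence \<open>Q * Q\<close> fix it.\<close>
    obtain y where y: "y ^ 3 = z"
      using nth_root_exists [of 3 z] by auto
    have y0: "y \<noteq> 0"
      using y assms(1) by auto
    have "y powi (3 * k) = 1"
      using zk1 unfolding y [symmetric] by (simp add: power_int_mult)
    then have "y powi Q = y"
      using y0 by (simp add: assms(4) power_int_add)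
    then have "y powi (Q * Q) = y"
      by (simp add: power_int_mult)
    then show "is_cube_in (GF ((2 ^ m)\<^sup>2)) z"
      unfolding is_cube_in_def using GF_iff y by blast
  qed
qed

section \<open>Counting cube roots\<close>

lemma cube_roots_of_unity:
  fixes \<omega> z :: F2_bar
  assumes "\<omega>\<^sup>2 = \<omega> + 1"
  shows "z ^ 3 = 1 \<longleftrightarrow> z \<in> {1, \<omega>, \<omega>\<^sup>2}"
proof -
  note \<omega>' = omega_mult_omega [OF assms]
  have "z ^ 3 + 1 = (z + 1) * ((z + \<omega>) * (z + \<omega>\<^sup>2))"
    by (simp add: expand_simps char2 \<omega>')
  then show ?thesis
    by (metis add_eq_0_F2_bar mult_eq_0_iff insert_iff empty_iff)
qed

lemma card_cube_roots:
  fixes \<omega> d :: F2_bar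
  assumes "\<omega>\<^sup>2 = \<omega> + 1" "d \<noteq> 0"
  shows "card {u. u ^ 3 = d} = 3"
proof -
  obtain y where y: "y ^ 3 = d"
    using nth_root_exists [of 3 d] by auto
  have y0: "y \<noteq> 0"
    using y assms(2) by auto
  have ne: "\<omega> \<noteq> 1" "\<omega> \<noteq> 0" "\<omega>\<^sup>2 \<noteq> 1" "\<omega>\<^sup>2 \<noteq> \<omega>"
    using assms(1) by (auto simp: char2)
  have "u ^ 3 = d \<longleftrightarrow> u \<in> (\<lambda>w. w * y) ` {1, \<omega>, \<omega>\<^sup>2}" for u
  proof -
    have "u ^ 3 = d \<longleftrightarrow> (u / y) ^ 3 = 1"
      using y0 by (simp add: power_divide y assms(2))
    also have "\<dots> \<longleftrightarrow> u / y \<in> {1, \<omega>, \<omega>\<^sup>2}"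
      by (rule cube_roots_of_unity [OF assms(1)])
    also have "\<dots> \<longleftrightarrow> u \<in> (\<lambda>w. w * y) ` {1, \<omega>, \<omega>\<^sup>2}"
      using y0 by (auto simp: field_simps)
    finally show ?thesis .
  qed
  then have "{u. u ^ 3 = d} = (\<lambda>w. w * y) ` {1, \<omega>, \<omega>\<^sup>2}"
    by blast
  also have "card \<dots> = card {1, \<omega>, \<omega>\<^sup>2}"
    using y0 by (intro card_image inj_onI) auto
  also have "\<dots> = 3"
    using ne by simp
  finally show ?thesis .
qed

text \<open>The involution \<open>cayley c\<close> carries the count over to the cube roots of
  \<open>d / c\<close>; \<open>c ^ 3 \<noteq> 1\<close> ensures that \<open>1 / c\<close>, the image
  of infinity, is not one of them.\<close>

lemma card_cayley_cube:
  fixes \<omega> c d :: F2_bar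
  assumes "\<omega>\<^sup>2 = \<omega> + 1" "c \<noteq> 0" "c ^ 3 \<noteq> 1" "d ^ 3 = 1"
  shows "card {x. c * cayley c x ^ 3 = d} = 3"
proof -
  have d0: "d \<noteq> 0"
    using assms(4) by auto
  have c2: "c\<^sup>2 \<noteq> 1"
  proof
    assume "c\<^sup>2 = 1"
    then have "(c + 1)\<^sup>2 = 0"
      by (simp add: expand_simps char2)
    then show False
      using assms(3) by (simp add: add_eq_0_F2_bar)
  qed
  have cu: "c * u \<noteq> 1" if "c * u ^ 3 = d" for u
  proof
    assume "c * u = 1"
    then have "u = 1 / c"
      using assms(2) by (simp add: field_simps)
    with that have "c\<^sup>2 * d = 1"
      using assms(2) by (auto simp: power2_eq_square power3_eq_cube)
    then have "(c\<^sup>2 * d) ^ 3 = 1"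
      by simp
    then have "(c ^ 3)\<^sup>2 = 1"
      by (simp add: power_mult_distrib assms(4) flip: power_mult)
    then have "(c ^ 3 + 1)\<^sup>2 = 0"
      by (simp add: power2_eq_square algebra_simps char2)
    then show False
      using assms(3) by (simp add: add_eq_0_F2_bar)
  qed
  \<comment> \<open>At the pole the default value 0 would give \<open>d = 0\<close>.\<close>
  have cx: "c * x \<noteq> 1" if "c * cayley c x ^ 3 = d" for x
    using that d0 by (auto simp: cayley_def char2)
  have "bij_betw (cayley c) {x. c * cayley c x ^ 3 = d} {u. c * u ^ 3 = d}"
    by (rule bij_betw_byWitness [where f' = "cayley c"]) (auto simp: cayley_cayley c2 cu cx)
  then have "card {x. c * cayley c x ^ 3 = d} = card {u. c * u ^ 3 = d}"
    by (rule bij_betw_same_card)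
  also have "{u. c * u ^ 3 = d} = {u. u ^ 3 = d / c}"
    using assms(2) by (auto simp: field_simps)
  also have "card \<dots> = 3"
    using assms(1,2) d0 by (intro card_cube_roots) auto
  finally show ?thesis .
qed

text \<open>Clearing denominators is valid even at the pole: there the left side reads
  \<open>0 = d\<close>, and the right side needs \<open>x = c\<close>, against
  \<open>c^2 \<noteq> 1\<close>.\<close>

lemma cayley_cube_iff:
  assumes "c \<noteq> 0" "c\<^sup>2 \<noteq> 1" "d \<noteq> 0"
  shows "c * cayley c x ^ 3 = d \<longleftrightarrow> c * (x + c) ^ 3 = d * (c * x + 1) ^ 3"
proof (cases "c * x + 1 = 0")
  case True
  then have "c * x = 1"
    by (simp add: add_eq_0_F2_bar)
  then have "x + c \<noteq> 0"
    using assms(2) by (auto simp: add_eq_0_F2_bar power2_eq_square)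
  then show ?thesis
    using True assms by (auto simp: cayley_def)
next
  case False
  then show ?thesis
    by (simp add: cayley_def power_divide divide_simps)
qed

section \<open>The set \<open>Gamma\<close> in the Cayley coordinate\<close>

lemma Gamma_iff:
  "x \<in> Gamma l q a \<longleftrightarrow> x * (x ^ (q ^ l) + 1)\<^sup>2 = a \<and> x ^ (q ^ 3) = x"
proof -
  \<comment> \<open>In characteristic two \<open>y^2 + 1 = (y + 1)^2\<close>, here with
    \<open>y = x ^ (q ^ l)\<close>.\<close>
  have "poly (monom 1 (2 * q ^ l + 1) + monom 1 1 + [:a:]) x = x * (x ^ (q ^ l) + 1)\<^sup>2 + a"
  proof -
    have "x ^ (2 * q ^ l + 1) = x * (x ^ (q ^ l))\<^sup>2"
      by (simp add: mult.commute flip: power_mult)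
    then show ?thesis
      by (simp add: poly_monom expand_simps char2)
  qed
  then show ?thesis
    by (simp add: Gamma_def roots_def GF_def add_eq_0_F2_bar)
qed

text \<open>The map \<open>t \<mapsto> a / (t + 1)^2\<close> interchanges \<open>c\<close> and
  \<open>1 / c\<close>, so such an \<open>x\<close> in \<open>Gamma\<close> has
  \<open>x ^ (q ^ l) = 1 / x\<close>. Three such steps invert \<open>x\<close>, yet return it
  because \<open>x ^ (q ^ 3) = x\<close>; this forces \<open>x^2 = 1\<close>.\<close>

lemma cayley_nonzero_on_Gamma:
  assumes "a * c = c\<^sup>2 + 1" "c\<^sup>2 \<noteq> 1" "c \<noteq> 0" "x \<in> Gamma l q a"
  shows "cayley c x \<noteq> 0"
proof
  assume "cayley c x = 0"
  then have "x = c \<or> c * x = 1"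
    by (simp add: cayley_def add_eq_0_F2_bar)
  then have x: "x = c \<or> x = inverse c"
    using inverse_unique by auto
  define y where "y = x ^ (q ^ l)"
  have G: "x * (y + 1)\<^sup>2 = a" "x ^ (q ^ 3) = x"
    using assms(4) by (simp_all add: Gamma_iff y_def)
  have x0: "x \<noteq> 0"
    using x assms(3) by auto
  \<comment> \<open>Both \<open>c\<close> and \<open>1 / c\<close> are roots of
    \<open>X^2 + a X + 1\<close>.\<close>
  have ax: "a * x = x\<^sup>2 + 1"
  proof (cases "x = c")
    case False
    then have "x * c = 1"
      using x assms(3) by simp
    have "(a * c) * x\<^sup>2 = a * x * (x * c)"
      by (simp add: power2_eq_square)
    then have "a * x = (a * c) * x\<^sup>2"
      by (simp only: \<open>x * c = 1\<close> mult_1_right)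
    also have "\<dots> = (x * c)\<^sup>2 + x\<^sup>2"
      unfolding assms(1) by (simp add: algebra_simps power_mult_distrib)
    finally show ?thesis
      using \<open>x * c = 1\<close> by (simp add: add.commute)
  qed (simp add: assms(1))
  have "(x * y + 1)\<^sup>2 = x * (x * (y + 1)\<^sup>2) + (x\<^sup>2 + 1)"
    by (simp add: expand_simps char2)
  also have "\<dots> = 0"
    unfolding G(1) by (simp add: mult.commute [of x] ax char2)
  finally have "x * y = 1"
    by (simp add: add_eq_0_F2_bar)
  then have y: "x ^ (q ^ l) = inverse x"
    unfolding y_def by (metis inverse_unique)
  have "x = x ^ ((q ^ 3) ^ l)"
  proof -
    have "x ^ ((q ^ 3) ^ n) = x" for n
      by (induction n) (simp_all add: power_mult G(2))
    then show ?thesis ..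
  qed
  also have "(q ^ 3) ^ l = q ^ l * q ^ l * q ^ l"
    by (metis power3_eq_cube power_mult mult.commute)
  also have "x ^ \<dots> = inverse x"
    by (simp only: power_mult y power_inverse inverse_inverse_eq)
  finally have "x\<^sup>2 = 1"
    using x0 by (metis power2_eq_square right_inverse)
  then show False
    using x assms(2) by (auto simp: power_inverse)
qed

text \<open>Frobenius powers turn into powers of \<open>Q\<close>, which reduces the claim to
  \<open>powi_conditions_iff\<close>; points with \<open>u = 0\<close> satisfy neither side.\<close>

lemma mem_Gamma_iff:
  fixes a c \<omega> x :: F2_bar and k e :: int
  assumes ac: "a * c = c\<^sup>2 + 1" "c\<^sup>2 \<noteq> 1" "c \<noteq> 0"
    and Q: "Q = (- 2) ^ m" "Q = 1 + 3 * k" "3 dvd k + int m" "c powi Q = c"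
    and \<omega>: "\<omega>\<^sup>2 = \<omega> + 1"
    and e: "c powi k = \<omega> powi e"
    and l: "coprime l 3"
  shows "x \<in> Gamma l (2 ^ m) a \<longleftrightarrow>
    (\<exists>j\<in>{0, 1, 2}. c * cayley c x ^ 3 = \<omega> ^ j \<and> 3 dvd e + int j * (int m + int l))"
proof -
  define u where "u = cayley c x"
  have \<omega>1: "\<omega> ^ 3 = 1" "\<omega> \<noteq> 1" and \<omega>0: "\<omega> \<noteq> 0"
    using cube_roots_of_unity [OF \<omega>] \<omega> by (auto simp: char2)
  have unity: "\<exists>j\<in>{0, 1, 2}. z = \<omega> ^ j" if "z ^ 3 = 1" for z
    using that unfolding cube_roots_of_unity [OF \<omega>] by auto
  have Frobenius: "cayley c (x ^ ((2 ^ m) ^ n)) = u powi (Q ^ n)" for n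
  proof -
    have "c powi ((- 2) ^ (m * n)) = c"
      using powi_power_fixed [OF Q(4)] by (simp add: Q(1) power_mult)
    from cayley_Frobenius [OF this ac(3)] show ?thesis
      by (simp add: u_def Q(1) power_mult)
  qed
  show ?thesis
  proof (cases "u = 0")
    case True
    then show ?thesis
      using cayley_nonzero_on_Gamma [OF ac] \<omega>0 by (auto simp: u_def)
  next
    case False
    have "x ^ ((2 ^ m) ^ 3) = x \<longleftrightarrow> u powi (Q ^ 3) = u"
    proof
      assume *: "u powi (Q ^ 3) = u"
      \<comment> \<open>A nonzero value rules out the pole, so the involution recovers the
        point.\<close>
      have inj: "cayley c (cayley c t) = t" if "cayley c t \<noteq> 0" for t
        using that ac(2) by (intro cayley_cayley) (auto simp: cayley_def char2)
      have "cayley c (x ^ ((2 ^ m) ^ 3)) = cayley c x"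
        unfolding Frobenius * by (simp add: u_def)
      then show "x ^ ((2 ^ m) ^ 3) = x"
        using False inj [of x] inj [of "x ^ ((2 ^ m) ^ 3)"] by (simp add: u_def)
    qed (use Frobenius [of 3] in \<open>simp add: u_def\<close>)
    moreover have "x * (x ^ ((2 ^ m) ^ l) + 1)\<^sup>2 = a \<longleftrightarrow> c * u * (u powi (Q ^ l))\<^sup>2 = 1"
    proof -
      have "cayley c (x ^ ((2 ^ m) ^ l)) \<noteq> 0"
        unfolding Frobenius using False by simp
      from cayley_conjugates_step [OF ac(1,3,2) False [unfolded u_def] this] show ?thesis
        unfolding Frobenius by (simp only: u_def)
    qed
    ultimately have "x \<in> Gamma l (2 ^ m) a \<longleftrightarrow>
        u powi (Q ^ 3) = u \<and> c * u * (u powi (Q ^ l))\<^sup>2 = 1"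
      unfolding Gamma_iff by blast
    also have "\<dots> \<longleftrightarrow> (\<exists>j\<in>{0, 1, 2}. c * u ^ 3 = \<omega> ^ j \<and> 3 dvd e + int j * (int m + int l))"
      by (rule powi_conditions_iff [OF False ac(3) Q(2,3,4) \<omega>1 unity e l])
    finally show ?thesis
      unfolding u_def .
  qed
qed

section \<open>The parameter \<open>c\<close> and the roots of the cubics\<close>

lemma GF4_minus_GF2:
  assumes "\<omega> \<in> GF 4 - GF 2"
  shows "\<omega>\<^sup>2 = \<omega> + 1"
proof -
  have w: "\<omega> * \<omega> ^ 3 = \<omega> * 1" "\<omega>\<^sup>2 \<noteq> \<omega>"
    using assms by (simp_all add: GF_def power4_eq_xxxx power3_eq_cube)
  then have "\<omega> \<noteq> 0" "\<omega> \<noteq> 1"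
    by auto
  with w(1) have "\<omega> ^ 3 = 1"
    by simp
  then have "(\<omega> + 1) * (\<omega>\<^sup>2 + (\<omega> + 1)) = 0"
    by (simp add: expand_simps char2)
  then show ?thesis
    using \<open>\<omega> \<noteq> 1\<close> by (simp add: add_eq_0_F2_bar)
qed

text \<open>\<open>b + \<omega>\<close> and \<open>b + \<omega>^2\<close> have sum 1 and product
  \<open>1 / a\<close>, whence the relation between \<open>a\<close> and \<open>c\<close>. The
  values \<omega> and \<open>\<omega>^2\<close> of \<open>c\<close> would mean \<open>b = 1\<close>
  and \<open>b = 0\<close>, so \<open>a = 1\<close>. The Frobenius fixes \<open>b\<close> and swaps
  \<omega> and \<open>\<omega>^2\<close> exactly for odd \<open>m\<close>, so it fixes or inverts
  \<open>c\<close>.\<close>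

lemma cayley_parameter:
  fixes a b c \<omega> :: F2_bar
  assumes a: "a \<noteq> 0" "a \<noteq> 1" and b: "b \<in> GF (2 ^ m)" "b\<^sup>2 + b + 1 = 1 / a"
    and \<omega>: "\<omega>\<^sup>2 = \<omega> + 1" and c: "c = (b + \<omega>) / (b + \<omega>\<^sup>2)"
  shows "c \<noteq> 0" and "a * c = c\<^sup>2 + 1" and "c\<^sup>2 \<noteq> 1" and "c ^ 3 \<noteq> 1"
    and "b * (c + 1) = \<omega>\<^sup>2 * c + \<omega>" and "c powi ((- 2) ^ m) = c"
proof -
  note \<omega>' = omega_mult_omega [OF \<omega>]
  have \<omega>1: "\<omega> \<noteq> 1"
    using \<omega> by (auto simp: char2)
  have prod: "a * ((b + \<omega>) * (b + \<omega>\<^sup>2)) = 1"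
  proof -
    have "(b + \<omega>) * (b + \<omega>\<^sup>2) = b\<^sup>2 + b + 1"
      by (simp add: expand_simps char2 \<omega>')
    then show ?thesis
      using b(2) a(1) by simp
  qed
  then have nz: "b + \<omega> \<noteq> 0" "b + \<omega>\<^sup>2 \<noteq> 0"
    by auto
  show c0: "c \<noteq> 0"
    using nz by (simp add: c)
  have cb: "c * (b + \<omega>\<^sup>2) = b + \<omega>"
    using nz by (simp add: c)
  show ac: "a * c = c\<^sup>2 + 1"
  proof -
    have "(c\<^sup>2 + 1) * (b + \<omega>\<^sup>2)\<^sup>2 = (c * (b + \<omega>\<^sup>2))\<^sup>2 + (b + \<omega>\<^sup>2)\<^sup>2"
      by (simp only: distrib_right [of "c\<^sup>2" 1] power_mult_distrib mult_1)
    also have "\<dots> = 1"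
      unfolding cb by (simp add: expand_simps char2 \<omega>')
    also have "\<dots> = a * (c * (b + \<omega>\<^sup>2)) * (b + \<omega>\<^sup>2)"
      unfolding cb using prod by (simp add: mult.assoc)
    also have "\<dots> = a * c * (b + \<omega>\<^sup>2)\<^sup>2"
      by (simp add: power2_eq_square mult.assoc)
    finally show ?thesis
      using nz(2) by simp
  qed
  then show c2: "c\<^sup>2 \<noteq> 1"
    using a(1) c0 by (auto simp: char2)
  show "c ^ 3 \<noteq> 1"
  proof
    assume "c ^ 3 = 1"
    moreover have "c \<noteq> 1"
      using c2 by auto
    ultimately have "c = \<omega> \<or> c = \<omega>\<^sup>2"
      using cube_roots_of_unity [OF \<omega>] by blast
    then have "(b + 1) * (\<omega> + 1) = 0 \<or> b * (\<omega>\<^sup>2 + 1) = 0"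
    proof
      assume "c = \<omega>"
      have "(b + 1) * (\<omega> + 1) = \<omega> * (b + \<omega>\<^sup>2) + (b + \<omega>)"
        by (simp add: expand_simps char2 \<omega>')
      also have "\<dots> = 0"
        by (simp only: cb [unfolded \<open>c = \<omega>\<close>] add_self_F2_bar)
      finally show ?thesis
        by blast
    next
      assume "c = \<omega>\<^sup>2"
      have "b * (\<omega>\<^sup>2 + 1) = \<omega>\<^sup>2 * (b + \<omega>\<^sup>2) + (b + \<omega>)"
        by (simp add: expand_simps char2 \<omega>')
      also have "\<dots> = 0"
        by (simp only: cb [unfolded \<open>c = \<omega>\<^sup>2\<close>] add_self_F2_bar)
      finally show ?thesis
        by blast
    qed
    moreover have "\<omega>\<^sup>2 + 1 = \<omega>" "\<omega> \<noteq> 0"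
      using \<omega> by (auto simp: char2 add.commute)
    ultimately have "b = 1 \<or> b = 0"
      using \<omega>1 by (simp add: add_eq_0_F2_bar)
    then have "1 / a = 1"
      using b(2) by (auto simp: char2)
    then show False
      using a by simp
  qed
  show "b * (c + 1) = \<omega>\<^sup>2 * c + \<omega>"
  proof -
    have "b * (c + 1) = c * (b + \<omega>\<^sup>2) + \<omega>\<^sup>2 * c + b"
      by (simp add: algebra_simps char2)
    then show ?thesis
      unfolding cb by (simp add: algebra_simps char2)
  qed
  show "c powi ((- 2) ^ m) = c"
  proof -
    have bm: "b ^ (2 ^ m) = b"
      using b(1) by (simp add: GF_def)
    have "\<omega> ^ (2 ^ m) = (if even m then \<omega> else \<omega>\<^sup>2)"
    proof (induction m)
      case (Suc m)
      have "\<omega> ^ (2 ^ Suc m) = (\<omega> ^ (2 ^ m))\<^sup>2"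
        by (simp add: power_mult mult.commute [of 2])
      then show ?case
        unfolding Suc by (simp add: power2_eq_square \<omega>' char2 algebra_simps)
    qed simp
    moreover have "(\<omega>\<^sup>2) ^ (2 ^ m) = (\<omega> ^ (2 ^ m))\<^sup>2"
      by (simp add: mult.commute flip: power_mult)
    moreover have "(\<omega>\<^sup>2)\<^sup>2 = \<omega>"
      by (simp add: power2_eq_square \<omega>' char2 algebra_simps)
    ultimately have cm: "c ^ (2 ^ m) = (if even m then c else inverse c)"
      unfolding c power_divide add_power_two_power bm by (simp add: inverse_eq_divide)
    show ?thesis
    proof (cases "even m")
      case True
      then have "(- 2 :: int) ^ m = int (2 ^ m)"
        by simp
      then show ?thesis
        using cm True by (simp only: power_int_of_nat if_True)
    next
      case False
      then have "(- 2 :: int) ^ m = - int (2 ^ m)"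
        by simp
      then show ?thesis
        using cm False by (simp only: power_int_minus power_int_of_nat if_False inverse_inverse_eq)
    qed
  qed
qed

text \<open>The indices 1 and 2 change places between the cubics and the exponents of \<omega>; this
  is the source of \<open>3 - i\<close> in the theorem.\<close>

lemma roots_eq_cayley_cubes:
  fixes a b c \<omega> :: F2_bar
  assumes ac: "a * c = c\<^sup>2 + 1" "c\<^sup>2 \<noteq> 1" "c \<noteq> 0" and \<omega>: "\<omega>\<^sup>2 = \<omega> + 1"
    and bc: "b * (c + 1) = \<omega>\<^sup>2 * c + \<omega>"
  shows "roots (f0 a) = {x. c * cayley c x ^ 3 = \<omega> ^ 0}"
    and "roots (f1 a b) = {x. c * cayley c x ^ 3 = \<omega> ^ 2}"
    and "roots (f2 a b) = {x. c * cayley c x ^ 3 = \<omega> ^ 1}"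
proof -
  have \<omega>0: "\<omega> \<noteq> 0"
    using \<omega> by auto
  have roots: "roots p = {x. c * cayley c x ^ 3 = d}"
    if "\<And>x. poly p x * s = c * (x + c) ^ 3 + d * (c * x + 1) ^ 3" "s \<noteq> 0" "d \<noteq> 0" for p s d
  proof -
    have "poly p x = 0 \<longleftrightarrow> c * cayley c x ^ 3 = d" for x
    proof -
      have "poly p x = 0 \<longleftrightarrow> c * (x + c) ^ 3 + d * (c * x + 1) ^ 3 = 0"
        unfolding that(1) [symmetric] using that(2) by simp
      then show ?thesis
        unfolding cayley_cube_iff [OF ac(3,2) that(3)] add_eq_0_F2_bar .
    qed
    then show ?thesis
      by (simp add: roots_def)
  qed
  note poly = poly_f0 [OF ac(1) \<omega> bc] poly_f1 [OF ac(1) \<omega> bc] poly_f2 [OF ac(1) \<omega> bc]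
  show "roots (f0 a) = {x. c * cayley c x ^ 3 = \<omega> ^ 0}"
    using roots [of "f0 a" "c * (c\<^sup>2 + 1)" 1] poly(1) ac by (simp add: add_eq_0_F2_bar)
  show "roots (f1 a b) = {x. c * cayley c x ^ 3 = \<omega> ^ 2}"
    by (rule roots [OF poly(2)]) (use ac(3) \<omega>0 in simp_all)
  show "roots (f2 a b) = {x. c * cayley c x ^ 3 = \<omega> ^ 1}"
    using roots [of "f2 a b" "c\<^sup>2 * \<omega>\<^sup>2" \<omega>] poly(3) ac(3) \<omega>0 by simp
qed

section \<open>Case analysis on \<open>m\<close>, \<open>l\<close> and \<open>e\<close> modulo
  3\<close>

theorem theorem5p3:
  fixes l m q N :: nat and a b \<omega> c :: F2_bar and \<Gamma> :: "F2_bar set" and f :: "nat \<Rightarrow> F2_bar poly"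
  assumes "l > 0" and "coprime l 3"
    and "m > 0" and "q = 2 ^ m"
    and "a \<in> GF q" and "a \<noteq> 0" and "a \<noteq> 1"
    and "trace m (1 / a) = trace m 1"
    and "b \<in> GF q" and "b\<^sup>2 + b + 1 = 1 / a"
    and "\<omega> \<in> GF 4 - GF 2"
    and "c = (b + \<omega>) / (b + \<omega>\<^sup>2)"
    and "\<Gamma> = Gamma l q a" and "N = card \<Gamma>"
    and "f 0 = f0 a" and "f 1 = f1 a b" and "f 2 = f2 a b"
  shows "(\<not> [int m = - int l] (mod 3) \<longrightarrow> N = 3) \<and>
    ([int m = - int l] (mod 3) \<longrightarrow>
      N \<in> {0, 9} \<and> (N = 9 \<longleftrightarrow> is_cube_in (GF (q\<^sup>2)) c)) \<and>
    ([m = 0] (mod 3) \<and> is_cube_in (GF (q\<^sup>2)) c \<longrightarrow> \<Gamma> = roots (f 0)) \<and>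
    ([m = 0] (mod 3) \<and> \<not> is_cube_in (GF (q\<^sup>2)) c \<longrightarrow> (\<exists>i\<in>{1, 2}. \<Gamma> = roots (f i))) \<and>
    ([m = l] (mod 3) \<longrightarrow>
      (\<exists>!i. i \<in> {0, 1, 2} \<and> is_cube_in (GF (q\<^sup>2)) (\<omega> ^ i * c)) \<and>
      (\<forall>i\<in>{0, 1, 2}. is_cube_in (GF (q\<^sup>2)) (\<omega> ^ i * c) \<longrightarrow>
        \<Gamma> = roots (if i = 0 then f 0 else f (3 - i)))) \<and>
    (N = 9 \<longrightarrow> \<Gamma> = roots (f 0 * f 1 * f 2))"
proof -
  have \<omega>: "\<omega>\<^sup>2 = \<omega> + 1"
    by (rule GF4_minus_GF2) fact
  then have \<omega>1: "\<omega> ^ 3 = 1" "\<omega> \<noteq> 1" and \<omega>0: "\<omega> \<noteq> 0"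
    using cube_roots_of_unity [OF \<omega>] by (auto simp: char2)
  note c = cayley_parameter [OF assms(6,7) assms(9) [unfolded assms(4)] assms(10) \<omega> assms(12)]
  define Q :: int where "Q = (- 2) ^ m"
  obtain k where k: "Q = 1 + 3 * k" "3 dvd k + int m"
    unfolding Q_def by (rule minus_two_power_mod_9)
  have cQ: "c powi Q = c"
    unfolding Q_def by (rule c(6))
  \<comment> \<open>The exponent is \<open>Q\<close>; cancelling one factor \<open>c\<close> makes
    \<open>c powi k\<close> a cube root of unity.\<close>
  have "c powi (1 + k * 3) = c"
    using cQ k(1) by (simp add: mult.commute)
  then have "(c powi k) ^ 3 = 1"
    using c(1) by (simp add: power_int_add power_int_mult)
  then have "c powi k \<in> {\<omega> powi 0, \<omega> powi 1, \<omega> powi 2}"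
    unfolding cube_roots_of_unity [OF \<omega>] by simp
  then obtain e where e: "c powi k = \<omega> powi e"
    by blast
  define S where "S j = {x. c * cayley c x ^ 3 = \<omega> ^ j}" for j :: nat
  have S: "roots (f 0) = S 0" "roots (f 1) = S 2" "roots (f 2) = S 1"
    unfolding assms(15-17) S_def
    using roots_eq_cayley_cubes [OF c(2,3,1) \<omega> c(5)] by simp_all
  have card_S: "card (S j) = 3" for j
    unfolding S_def
    by (rule card_cayley_cube [OF \<omega> c(1,4)]) (metis \<omega>1(1) power_mult mult.commute power_one)
  then have fin: "finite (S j)" for j
    by (metis card.infinite zero_neq_numeral)
  have disj: "S 0 \<inter> S 1 = {}" "S 0 \<inter> S 2 = {}" "S 1 \<inter> S 2 = {}"
    using \<omega> \<omega>1(2) \<omega>0 by (auto simp: S_def char2)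
  \<comment> \<open>The criterion for the class \<open>S j\<close> to lie in \<Gamma>.\<close>
  define J where "J j \<longleftrightarrow> 3 dvd e + int j * (int m + int l)" for j :: nat
  define C where "C i \<longleftrightarrow> is_cube_in (GF (q\<^sup>2)) (\<omega> ^ i * c)" for i
  have \<Gamma>: "\<Gamma> = (\<Union>j\<in>{j \<in> {0, 1, 2}. J j}. S j)"
  proof (rule Set.set_eqI)
    fix x
    show "x \<in> \<Gamma> \<longleftrightarrow> x \<in> (\<Union>j\<in>{j \<in> {0, 1, 2}. J j}. S j)"
      unfolding assms(13,4) S_def J_def mem_Gamma_iff [OF c(2,3,1) Q_def k cQ \<omega> e assms(2)]
      by blast
  qed
  \<comment> \<open>Euler's criterion applies to \<open>\<omega> ^ i * c\<close> because
    \<open>Q\<close> is 1 modulo 3 and so fixes \<omega>; then \<open>k\<close> is replaced by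
    \<open>- m\<close> modulo 3.\<close>
  have C: "C i \<longleftrightarrow> 3 dvd e - int i * int m" for i
  proof -
    have "\<omega> powi Q = \<omega>"
      using \<omega>0 \<omega>1(1) by (simp add: k(1) power_int_add power_int_mult)
    then have "(\<omega> ^ i) powi Q = \<omega> ^ i"
      by (metis power_int_mult power_int_of_nat mult.commute)
    then have "(\<omega> ^ i * c) powi Q = \<omega> ^ i * c"
      using cQ by (simp add: power_int_mult_distrib)
    then have "C i \<longleftrightarrow> (\<omega> ^ i * c) powi k = 1"
      unfolding C_def assms(4) using \<omega>0 c(1) by (intro is_cube_in_iff [OF _ _ Q_def k(1)]) simp_all
    also have "(\<omega> ^ i * c) powi k = \<omega> powi (int i * k + e)"
      using \<omega>0 by (simp add: power_int_mult_distrib e power_int_add power_int_mult)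
    also have "\<dots> = 1 \<longleftrightarrow> 3 dvd int i * k + e"
      by (rule omega_powi_eq_1_iff [OF \<omega>1])
    also have "int i * k + e = (e - int i * int m) + int i * (k + int m)"
      by (simp add: algebra_simps)
    also have "3 dvd \<dots> \<longleftrightarrow> 3 dvd e - int i * int m"
      using k(2) by (simp add: dvd_add_left_iff)
    finally show ?thesis .
  qed
  have l: "\<not> 3 dvd int l"
  proof
    assume "3 dvd int l"
    then have "3 dvd int l * int l"
      by simp
    moreover obtain t where "int l * int l = 1 + 3 * t"
      using coprime_3_square [OF assms(2)] by blast
    ultimately show False
      by presburger
  qed
  have cong: "[int m = - int l] (mod 3) \<longleftrightarrow> 3 dvd int m + int l"
    "[m = 0] (mod 3) \<longleftrightarrow> 3 dvd int m" "[m = l] (mod 3) \<longleftrightarrow> 3 dvd int m - int l"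
    by (simp_all add: cong_iff_dvd_diff flip: cong_int_iff)
  \<comment> \<open>Here \<open>j\<close> drops out of \<open>J j\<close>, leaving
    \<open>3 dvd e\<close>, which is \<open>C 0\<close>.\<close>
  have all: "J 0 \<and> J 1 \<and> J 2" if "3 dvd int m + int l" "C 0"
    using that unfolding J_def C by simp presburger
  have none: "\<not> J 0 \<and> \<not> J 1 \<and> \<not> J 2" if "3 dvd int m + int l" "\<not> C 0"
    using that unfolding J_def C by simp presburger
  \<comment> \<open>Now \<open>e + j * (m + l)\<close> takes each residue modulo 3 once as
    \<open>j\<close> runs through 0, 1, 2.\<close>
  have one: "J 0 \<and> \<not> J 1 \<and> \<not> J 2 \<or> \<not> J 0 \<and> J 1 \<and> \<not> J 2 \<or> \<not> J 0 \<and> \<not> J 1 \<and> J 2"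
    if "\<not> 3 dvd int m + int l"
    using that unfolding J_def by simp presburger
  \<comment> \<open>Modulo 3 the sum \<open>m + l\<close> is \<open>l\<close> or
    \<open>2 * l\<close>.\<close>
  have not_dvd: "\<not> 3 dvd int m + int l" if "3 dvd int m \<or> 3 dvd int m - int l"
    using that l by presburger
  have JC0: "J 0 \<longleftrightarrow> C 0"
    unfolding J_def C by simp
  \<comment> \<open>With \<open>m\<close> and \<open>l\<close> equal modulo 3, \<open>m + l\<close>
    is \<open>- m\<close>, so \<open>J\<close> and \<open>C\<close> are the same congruence.\<close>
  have JC: "J 1 \<longleftrightarrow> C 1" "J 2 \<longleftrightarrow> C 2" if "3 dvd int m - int l"
    using that unfolding J_def C by (simp, presburger)+
  have \<Gamma>_all: "\<Gamma> = S 0 \<union> S 1 \<union> S 2" "N = 9" if "J 0 \<and> J 1 \<and> J 2"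
  proof -
    have "{j \<in> {0, 1, 2}. J j} = {0, 1, 2}"
      using that by auto
    then show *: "\<Gamma> = S 0 \<union> S 1 \<union> S 2"
      unfolding \<Gamma> by auto
    have "(S 0 \<union> S 1) \<inter> S 2 = {}"
      using disj by blast
    then show "N = 9"
      unfolding assms(14) * by (simp only: card_Un_disjoint finite_Un fin disj card_S)
  qed
  have \<Gamma>_none: "N = 0" if "\<not> J 0 \<and> \<not> J 1 \<and> \<not> J 2"
  proof -
    have "{j \<in> {0, 1, 2}. J j} = {}"
      using that by blast
    then show ?thesis
      unfolding assms(14) \<Gamma> by (simp only: UN_empty card.empty)
  qed
  have \<Gamma>_one: "\<Gamma> = S j" "N = 3" if "j \<in> {0, 1, 2}" "J j" "\<not> 3 dvd int m + int l" for j
  proof -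
    have "{j \<in> {0, 1, 2}. J j} = {j}"
      using that(1,2) one [OF that(3)] by auto
    then show "\<Gamma> = S j"
      unfolding \<Gamma> by simp
    then show "N = 3"
      by (simp add: assms(14) card_S)
  qed
  have N3: "N = 3" if "\<not> 3 dvd int m + int l"
    using one [OF that] \<Gamma>_one(2) [OF _ _ that] by blast
  have N9: "N = 9 \<longleftrightarrow> 3 dvd int m + int l \<and> C 0"
  proof (cases "3 dvd int m + int l")
    case True
    then show ?thesis
      using all none \<Gamma>_all(2) \<Gamma>_none by (cases "C 0") auto
  qed (simp add: N3)
  have C0: "C 0 \<longleftrightarrow> is_cube_in (GF (q\<^sup>2)) c"
    by (simp add: C_def)
  have p1: "\<not> 3 dvd int m + int l \<longrightarrow> N = 3"
    using N3 by blast
  have p2: "3 dvd int m + int l \<longrightarrow> N \<in> {0, 9} \<and> (N = 9 \<longleftrightarrow> C 0)"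
    using N9 none \<Gamma>_none by auto
  have p3: "3 dvd int m \<and> C 0 \<longrightarrow> \<Gamma> = roots (f 0)"
    unfolding S using \<Gamma>_one(1) [of 0] not_dvd JC0 by auto
  have p4: "3 dvd int m \<and> \<not> C 0 \<longrightarrow> (\<exists>i\<in>{1, 2}. \<Gamma> = roots (f i))"
  proof
    assume *: "3 dvd int m \<and> \<not> C 0"
    \<comment> \<open>Exactly one class lies in \<Gamma>, and \<open>J 0\<close> fails together with
      \<open>C 0\<close>.\<close>
    then have "\<not> 3 dvd int m + int l" "J 1 \<or> J 2"
      using one not_dvd JC0 by auto
    then have "\<Gamma> = roots (f 2) \<or> \<Gamma> = roots (f 1)"
      unfolding S using \<Gamma>_one(1) by blast
    then show "\<exists>i\<in>{1, 2}. \<Gamma> = roots (f i)"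
      by blast
  qed
  have p5: "3 dvd int m - int l \<longrightarrow> (\<exists>!i. i \<in> {0, 1, 2} \<and> C i) \<and>
      (\<forall>i\<in>{0, 1, 2}. C i \<longrightarrow> \<Gamma> = roots (if i = 0 then f 0 else f (3 - i)))"
  proof
    assume *: "3 dvd int m - int l"
    then have n: "\<not> 3 dvd int m + int l"
      using not_dvd by blast
    have "\<exists>!i. i \<in> {0, 1, 2} \<and> C i"
      using one [OF n] unfolding JC0 JC [OF *] by auto
    moreover have "\<Gamma> = roots (if i = 0 then f 0 else f (3 - i))" if i: "i \<in> {0, 1, 2}" "C i" for i
    proof -
      have "J i"
        using i JC0 JC [OF *] by auto
      then have "\<Gamma> = S i"
        using \<Gamma>_one(1) i(1) n by blast
      moreover have "(3 :: nat) - 1 = 2" "(3 :: nat) - 2 = 1"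
        by simp_all
      ultimately show ?thesis
        using i(1) S by (elim insertE emptyE) (simp_all only: if_True if_False, simp_all)
    qed
    ultimately show "(\<exists>!i. i \<in> {0, 1, 2} \<and> C i) \<and>
        (\<forall>i\<in>{0, 1, 2}. C i \<longrightarrow> \<Gamma> = roots (if i = 0 then f 0 else f (3 - i)))"
      by blast
  qed
  have p6: "N = 9 \<longrightarrow> \<Gamma> = roots (f 0 * f 1 * f 2)"
  proof
    assume "N = 9"
    then have "\<Gamma> = S 0 \<union> S 1 \<union> S 2"
      using N9 all \<Gamma>_all(1) by blast
    also have "\<dots> = roots (f 0) \<union> roots (f 1) \<union> roots (f 2)"
      unfolding S by blast
    also have "\<dots> = roots (f 0 * f 1 * f 2)"
      by (auto simp: roots_def)
    finally show "\<Gamma> = roots (f 0 * f 1 * f 2)" .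
  qed
  show ?thesis
    unfolding cong C0 [symmetric] C_def [symmetric] by (intro conjI p1 p2 p3 p4 p5 p6)
qed

end
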